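(* Let $d\ge 1$ and $k\in\mathbb N$. The function $\mathbf h\mapsto M_k(\mathbf h)$ attains its maximum over the set $\Delta_d$ at a unique point, namely $\mathbf h=\mathbf e=(1,\dots,1)$. That is, $M_k(\mathbf h)\le M_k(\mathbf e)$ for every $\mathbf h\in\Delta_d$, and $M_k(\mathbf h)<M_k(\mathbf e)$ for every $\mathbf h\in\Delta_d\setminus\{\mathbf e\}$.
   Context: Let $\mathbb R_+=[0,\infty)$ and $\|f\|_{\mathbb R_+}=\sup_{t\ge 0}|f(t)|$. For a vector $\mathbf h=(h_1,\dots,h_d)$ with $0<h_1\le\cdots\le h_d$, let $\mathcal P_{\mathbf h}$ be the $d$-dimensional space of real functions on $\mathbb R_+$ spanned by the following system: each distinct value $\eta$ occurring exactly $m$ times among $h_1,\dots,h_d$ contributes the $m$ functions $e^{-\eta t}, te^{-\eta t},\dots,t^{m-1}e^{-\eta t}$ (so if all $h_i$ are distinct, $\mathcal P_{\mathbf h}=\{\sum_{i=1}^d p_ie^{-h_it}: p_i\in\mathbb R\}$). For $k\in\mathbb N$, $M_k(\mathbf h)=\max\{\|p^{(k)}\|_{\mathbb R_+}: p\in\mathcal P_{\mathbf h},\ \|p\|_{\mathbb R_+}\le 1\}$. Let $\Delta_d=\{\mathbf h\in\mathbb R^d: 0<h_1\le\cdots\le h_d\le 1\}$ and $\mathbf e=(1,\dots,1)\in\mathbb R^d$; thus $\mathcal P_{\mathbf e}=\{e^{-t}q(t): q\text{ a real algebraic polynomial of degree}\le d-1\}$. *)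

theory Defs
  imports "HOL-Analysis.Analysis"
begin

definition supnorm_Rplus :: "(real \<Rightarrow> real) \<Rightarrow> real" where
  "supnorm_Rplus f = (SUP t\<in>{0..}. \<bar>f t\<bar>)"

text \<open>Multiplicity exponent: the i-th entry of h gets the power t^j where j is the
  number of earlier entries equal to it. Thus each distinct value eta occurring
  m times contributes exp(-eta t), t exp(-eta t), ..., t^(m-1) exp(-eta t).\<close>
definition mult_exp :: "real list \<Rightarrow> nat \<Rightarrow> nat" where
  "mult_exp h i = card {l. l < i \<and> h ! l = h ! i}"

definition P_space :: "real list \<Rightarrow> (real \<Rightarrow> real) set" where
  "P_space h = {p. \<exists>c :: nat \<Rightarrow> real.
      p = (\<lambda>t. \<Sum>i<length h. c i * t ^ mult_exp h i * exp (- (h ! i) * t))}"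

definition M :: "nat \<Rightarrow> real list \<Rightarrow> real" where
  "M k h = Sup {supnorm_Rplus ((deriv ^^ k) p) | p. p \<in> P_space h \<and> supnorm_Rplus p \<le> 1}"

definition Delta :: "nat \<Rightarrow> real list set" where
  "Delta d = {h. length h = d \<and> sorted h \<and> (\<forall>x\<in>set h. 0 < x \<and> x \<le> 1)}"

end

theory Submission
  imports Defs
begin

text \<open>
  The space of \<open>h\<close> is the kernel of the product of the operators \<open>d/dt + h\<^sub>i\<close>, so by Rolle its
  nonzero elements have at most \<open>d - 1\<close> real zeros. Let \<open>\<phi> p = (deriv ^^ k) p 0\<close>;
  by translation invariance \<open>M k h\<close> is the norm of \<open>\<phi>\<close>. A maximizer \<open>T\<close> satisfies \<open>\<bar>T\<bar> = 1\<close> at exactly \<open>d\<close> points, \<open>d - 1\<close> of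
  which are positive zeros of its derivative, since otherwise interpolation yields a perturbation
  that lowers the norm and preserves \<open>\<phi>\<close>.

  Raise a single exponent \<open>b\<close> to \<open>b'\<close>. Let \<open>T\<close> be a maximizer for the old exponents and \<open>v\<close> the element
  of the new space that agrees with \<open>T\<close> at the \<open>d\<close> extremal points of the new maximizer; optimality of
  the latter gives \<open>\<phi> v \<le> M'\<close>. Both \<open>T\<close> and \<open>T - v\<close> have the maximal number of zeros (of the derivative)
  in their spaces, so the signs of \<open>\<phi>\<close> on them are determined by the coefficient of \<open>exp (- b t)\<close>, and
  the two signs are opposite because the numbers of zeros differ by one. Hence
  \<open>M = \<phi> T < \<phi> v \<le> M'\<close>. Raising the exponents to 1 one after the other proves the theorem.
\<close>

subsection \<open>Kernels of products of first-order operators\<close>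

text \<open>Since \<open>deriv\<close> is total, differentiability of every iterate has to be
  demanded explicitly. It is demanded on the whole line, so that 0 is an interior point.\<close>

definition smooth :: "(real \<Rightarrow> real) \<Rightarrow> bool" where
  "smooth f \<longleftrightarrow> (\<forall>k t. (deriv ^^ k) f differentiable at t)"

text \<open>The factor d/dt + a, which is \<open>exp (- a * t)\<close> times the derivative of
  \<open>exp (a * t) * f t\<close>; this form is what lets Rolle's theorem pass through it.\<close>

definition dop :: "real \<Rightarrow> (real \<Rightarrow> real) \<Rightarrow> real \<Rightarrow> real" where
  "dop a f = (\<lambda>t. deriv f t + a * f t)"

definition ops :: "real list \<Rightarrow> (real \<Rightarrow> real) \<Rightarrow> real \<Rightarrow> real" where
  "ops h = fold dop h"

text \<open>The solution space of a linear differential equation with constant coefficients whose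
  characteristic roots are the negated entries of \<open>h\<close>. Coinciding exponents need no
  separate treatment, unlike in \<open>P_space\<close>.\<close>

definition ES :: "real list \<Rightarrow> (real \<Rightarrow> real) set" where
  "ES h = {f. smooth f \<and> ops h f = (\<lambda>_. 0)}"

section \<open>Smooth functions and linearity of the first-order operators\<close>

lemma ops_simps [simp]:
  "ops [] f = f" "ops (a # h) f = ops h (dop a f)" "ops (h @ g) f = ops g (ops h f)"
  by (simp_all add: ops_def)

lemma smooth_DERIV: "smooth f \<Longrightarrow> (f has_real_derivative deriv f t) (at t)"
  unfolding smooth_def
  by (metis DERIV_deriv_iff_real_differentiable funpow_0)

lemma smooth_continuous: "smooth f \<Longrightarrow> continuous_on A f"
  by (meson DERIV_isCont continuous_at_imp_continuous_on smooth_DERIV)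

lemma smooth_deriv: "smooth f \<Longrightarrow> smooth (deriv f)"
  unfolding smooth_def by (metis comp_apply funpow_Suc_right)

lemma smooth_funpow_deriv: "smooth f \<Longrightarrow> smooth ((deriv ^^ k) f)"
  by (induction k) (simp_all add: smooth_deriv)

lemma funpow_deriv_lincomb:
  assumes "smooth f" "smooth g"
  shows "(deriv ^^ k) (\<lambda>t. a * f t + b * g t) = (\<lambda>t. a * (deriv ^^ k) f t + b * (deriv ^^ k) g t)"
proof (induction k)
  case (Suc k)
  have "deriv (\<lambda>t. a * (deriv ^^ k) f t + b * (deriv ^^ k) g t) t
      = a * deriv ((deriv ^^ k) f) t + b * deriv ((deriv ^^ k) g) t" for t
    by (rule DERIV_imp_deriv)
      (intro derivative_intros smooth_DERIV[OF smooth_funpow_deriv] assms | 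
       auto intro!: derivative_eq_intros smooth_DERIV smooth_funpow_deriv assms)+
  then show ?case using Suc by auto
qed simp

lemma smooth_lincomb:
  assumes "smooth f" "smooth g"
  shows "smooth (\<lambda>t. a * f t + b * g t)"
  unfolding smooth_def funpow_deriv_lincomb[OF assms]
  using assms by (auto simp: smooth_def intro!: derivative_intros)

lemma deriv_lincomb:
  assumes "smooth f" "smooth g"
  shows "deriv (\<lambda>t. a * f t + b * g t) = (\<lambda>t. a * deriv f t + b * deriv g t)"
  using funpow_deriv_lincomb[OF assms, of 1] by simp

lemma funpow_deriv_zero [simp]: "(deriv ^^ k) (\<lambda>_. 0 :: real) = (\<lambda>_. 0)"
  by (induction k) auto

lemma smooth_zero: "smooth (\<lambda>_. 0)"
  by (simp add: smooth_def)

lemma smooth_dop: "smooth f \<Longrightarrow> smooth (dop a f)"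
  using smooth_lincomb[of "deriv f" f 1 a] smooth_deriv by (simp add: dop_def)

lemma dop_lincomb:
  assumes "smooth f" "smooth g"
  shows "dop c (\<lambda>t. a * f t + b * g t) = (\<lambda>t. a * dop c f t + b * dop c g t)"
  by (auto simp: dop_def deriv_lincomb[OF assms] algebra_simps)

lemma dop_0: "dop 0 f = deriv f"
  by (simp add: dop_def)

lemma dop_zero: "dop a (\<lambda>_. 0) = (\<lambda>_. 0)"
  by (simp add: dop_def)

lemma dop_commute: "smooth f \<Longrightarrow> dop a (dop b f) = dop b (dop a f)"
  using deriv_lincomb[of "deriv f" f 1 a] deriv_lincomb[of "deriv f" f 1 b] smooth_deriv[of f]
  by (auto simp: dop_def algebra_simps)

lemma smooth_ops: "smooth f \<Longrightarrow> smooth (ops h f)"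
  by (induction h arbitrary: f) (auto simp: smooth_dop)

lemma ops_lincomb:
  assumes "smooth f" "smooth g"
  shows "ops h (\<lambda>t. a * f t + b * g t) = (\<lambda>t. a * ops h f t + b * ops h g t)"
  using assms by (induction h arbitrary: f g) (auto simp: smooth_dop dop_lincomb)

lemma ops_zero: "ops h (\<lambda>_. 0) = (\<lambda>_. 0)"
  by (induction h) (auto simp: dop_zero)

lemma ops_dop: "smooth f \<Longrightarrow> ops h (dop a f) = dop a (ops h f)"
proof (induction h arbitrary: f)
  case (Cons b h)
  have "ops (b # h) (dop a f) = ops h (dop a (dop b f))"
    using Cons.prems by (simp add: dop_commute)
  then show ?case using Cons by (simp add: smooth_dop)
qed simp

lemma ops_funpow_deriv: "smooth f \<Longrightarrow> ops h ((deriv ^^ k) f) = (deriv ^^ k) (ops h f)"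
proof (induction k)
  case (Suc k)
  then show ?case
    using ops_dop[of "(deriv ^^ k) f" h 0] smooth_funpow_deriv by (simp add: dop_0)
qed simp

section \<open>Closure properties of the kernel\<close>

lemma ES_smooth: "f \<in> ES h \<Longrightarrow> smooth f"
  by (simp add: ES_def)

lemma ES_lincomb: "f \<in> ES h \<Longrightarrow> g \<in> ES h \<Longrightarrow> (\<lambda>t. a * f t + b * g t) \<in> ES h"
  by (simp add: ES_def smooth_lincomb ops_lincomb)

lemma ES_zero: "(\<lambda>_. 0) \<in> ES h"
  by (simp add: ES_def smooth_zero ops_zero)

lemma ES_scale: "f \<in> ES h \<Longrightarrow> (\<lambda>t. a * f t) \<in> ES h"
  using ES_lincomb[of f h f a 0] by simp

lemma ES_diff: "f \<in> ES h \<Longrightarrow> g \<in> ES h \<Longrightarrow> (\<lambda>t. f t - g t) \<in> ES h"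
  using ES_lincomb[of f h g 1 "-1"] by simp

lemma ES_funpow_deriv: "f \<in> ES h \<Longrightarrow> (deriv ^^ k) f \<in> ES h"
  by (simp add: ES_def smooth_funpow_deriv ops_funpow_deriv)

lemma ES_deriv: "f \<in> ES h \<Longrightarrow> deriv f \<in> ES h"
  using ES_funpow_deriv[of f h 1] by simp

lemma ES_sum:
  fixes n :: nat
  assumes "\<And>i. i < n \<Longrightarrow> f i \<in> ES h"
  shows "(\<lambda>t. \<Sum>i<n. c i * f i t) \<in> ES h"
    and "(deriv ^^ k) (\<lambda>t. \<Sum>i<n. c i * f i t) = (\<lambda>t. \<Sum>i<n. c i * (deriv ^^ k) (f i) t)"
proof -
  have "(\<lambda>t. \<Sum>i<n. c i * f i t) \<in> ES h \<and>
    (deriv ^^ k) (\<lambda>t. \<Sum>i<n. c i * f i t) = (\<lambda>t. \<Sum>i<n. c i * (deriv ^^ k) (f i) t)"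
    using assms
  proof (induction n)
    case 0
    then show ?case by (simp add: ES_zero)
  next
    case (Suc n)
    then have *: "(\<lambda>t. \<Sum>i<n. c i * f i t) \<in> ES h" "f n \<in> ES h" by auto
    show ?case
      using Suc ES_lincomb[OF *, of 1 "c n"]
        funpow_deriv_lincomb[OF *[THEN ES_smooth], of k 1 "c n"] by simp
  qed
  then show "(\<lambda>t. \<Sum>i<n. c i * f i t) \<in> ES h"
    "(deriv ^^ k) (\<lambda>t. \<Sum>i<n. c i * f i t) = (\<lambda>t. \<Sum>i<n. c i * (deriv ^^ k) (f i) t)" by auto
qed

lemma ES_Cons: "f \<in> ES (a # h) \<longleftrightarrow> smooth f \<and> dop a f \<in> ES h"
  by (auto simp: ES_def smooth_dop)

text \<open>The factors commute, so the order of the exponents is immaterial and any one of them can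
  be brought to the end of the list.\<close>

lemma ES_rotate: "ES (a # h) = ES (h @ [a])"
  by (auto simp: ES_def ops_dop)

lemma ES_snocI: "f \<in> ES h \<Longrightarrow> f \<in> ES (h @ [a])"
  by (simp add: ES_def dop_zero)

lemma dop_eq_zeroD:
  assumes "smooth f" "dop a f = (\<lambda>_. 0)"
  shows "f = (\<lambda>t. f 0 * exp (- a * t))"
proof
  fix t
  have "((\<lambda>t. exp (a * t) * f t) has_real_derivative 0) (at s)" for s
  proof -
    have "deriv f s + a * f s = 0" using fun_cong[OF assms(2), of s] by (simp add: dop_def)
    then have "exp (a * s) * deriv f s + exp (a * s) * a * f s = 0"
      by (metis distrib_left mult.assoc mult_zero_right)
    then show ?thesis
      by (auto intro!: derivative_eq_intros smooth_DERIV[OF assms(1)] simp: algebra_simps)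
  qed
  then have "exp (a * t) * f t = exp (a * 0) * f 0"
    using DERIV_isconst_all by blast
  then have "exp (- (a * t)) * (exp (a * t) * f t) = exp (- (a * t)) * f 0" by simp
  then show "f t = f 0 * exp (- a * t)"
    by (simp add: mult.assoc[symmetric] exp_minus field_simps)
qed

text \<open>All factors but the last leave a multiple of \<open>exp (- a * t)\<close>. Its
  coefficient \<open>ops h f 0\<close> acts as a leading coefficient in the sign arguments.\<close>

lemma ES_snocD:
  assumes "f \<in> ES (h @ [a])"
  shows "ops h f = (\<lambda>t. ops h f 0 * exp (- a * t))"
  using dop_eq_zeroD[of "ops h f" a] assms by (auto simp: ES_def smooth_ops)

subsection \<open>Counting zeros\<close>

text \<open>Induction that removes the largest zero: the last gap supplies one new zero. The strict
  bounds keep the new zeros distinct and to the right of the smallest old one.\<close>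

lemma Rolle_card:
  fixes g g' :: "real \<Rightarrow> real"
  assumes g': "\<And>t. (g has_real_derivative g' t) (at t)"
  shows "finite A \<Longrightarrow> card A = Suc n \<Longrightarrow> \<forall>t\<in>A. g t = 0 \<Longrightarrow>
    \<exists>B. finite B \<and> card B = n \<and> (\<forall>t\<in>B. g' t = 0 \<and> Min A < t \<and> t < Max A)"
proof (induction n arbitrary: A)
  case 0
  then show ?case by (intro exI[of _ "{}"]) auto
next
  case (Suc n)
  define m where "m = Max A"
  define A' where "A' = A - {m}"
  have "A \<noteq> {}" using Suc.prems by auto
  then have m: "m \<in> A" using Suc.prems by (simp add: m_def)
  have A': "finite A'" "card A' = Suc n" "\<forall>t\<in>A'. g t = 0"
    using Suc.prems m by (auto simp: A'_def)
  then obtain B where B: "finite B" "card B = n"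
      "\<And>t. t \<in> B \<Longrightarrow> g' t = 0 \<and> Min A' < t \<and> t < Max A'"
    using Suc.IH[OF A'] by blast
  have ne: "A' \<noteq> {}" using A' by auto
  have M: "Max A' \<in> A'" using A' ne by simp
  have lt: "Max A' < m"
    using M Max_ge[of A "Max A'"] Suc.prems by (auto simp: A'_def m_def less_le)
  have min: "Min A \<le> Min A'"
    using ne Suc.prems by (intro Min_antimono) (auto simp: A'_def)
  have "g (Max A') = g m" using M m Suc.prems by (auto simp: A'_def)
  moreover have "continuous_on {Max A'..m} g"
    by (meson DERIV_isCont continuous_at_imp_continuous_on g')
  \<comment> \<open>\<open>Rolle_deriv\<close> treats the derivative as a linear map; evaluating the
    vanishing map at 1 gives \<open>g' z = 0\<close>.\<close>
  ultimately obtain z where z: "Max A' < z" "z < m" "(\<lambda>x. x * g' z) = (\<lambda>_. 0)"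
    using Rolle_deriv[OF lt, of g "\<lambda>t x. x * g' t"] g'
    by (metis has_field_derivative_imp_has_derivative mult_commute_abs)
  then have "g' z = 0" by (metis mult_1)
  have "Min A' \<le> Max A'" using A' ne by simp
  have "z \<notin> B" using B(3)[of z] z by auto
  then have "card (insert z B) = Suc n" using B by simp
  moreover have "g' t = 0 \<and> Min A < t \<and> t < m" if "t \<in> insert z B" for t
    using that B(3)[of t] z \<open>g' z = 0\<close> min lt \<open>Min A' \<le> Max A'\<close> by auto
  ultimately show ?case
    using B(1) unfolding m_def by (intro exI[of _ "insert z B"]) simp
qed

text \<open>\<open>exp (a * t) * f t\<close> has the zeros of \<open>f\<close>, and its derivative
  has those of \<open>dop a f\<close>.\<close>

lemma Rolle_dop:
  assumes f: "smooth f" and A: "finite A" "card A = Suc n" "\<forall>t\<in>A. f t = 0"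
  shows "\<exists>B. finite B \<and> card B = n \<and> (\<forall>t\<in>B. dop a f t = 0 \<and> Min A < t \<and> t < Max A)"
proof -
  have "((\<lambda>t. exp (a * t) * f t) has_real_derivative exp (a * t) * dop a f t) (at t)" for t
    by (auto intro!: derivative_eq_intros smooth_DERIV[OF f] simp: dop_def algebra_simps)
  from Rolle_card[OF this, of A n] show ?thesis using A by auto
qed

text \<open>Each factor costs at most one zero by Rolle, so \<open>dop a f\<close> vanishes by
  induction; the multiple of an exponential that remains has a zero only if it is 0.\<close>

lemma ES_eq_zero:
  assumes "f \<in> ES h" "finite A" "length h \<le> card A" "\<forall>t\<in>A. f t = 0"
  shows "f = (\<lambda>_. 0)"
  using assms
proof (induction h arbitrary: f A)
  case Nil
  then show ?case by (simp add: ES_def)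
next
  case (Cons a h)
  then have f: "smooth f" "dop a f \<in> ES h" by (auto simp: ES_Cons)
  obtain n where n: "card A = Suc n" using Cons.prems by (cases "card A") auto
  obtain B where B: "finite B" "card B = n" "\<forall>t\<in>B. dop a f t = 0"
    using Rolle_dop[OF f(1) Cons.prems(2) n] Cons.prems(4) by blast
  have "dop a f = (\<lambda>_. 0)"
    using Cons.IH[OF f(2) B(1)] B Cons.prems n by simp
  then have 1: "f = (\<lambda>t. f 0 * exp (- a * t))"
    using dop_eq_zeroD f(1) by blast
  obtain x where "x \<in> A" using n by fastforce
  then have "f 0 * exp (- a * x) = 0" using 1 Cons.prems(4) by metis
  then have "f 0 = 0" by simp
  then have "f t = 0" for t using fun_cong[OF 1, of t] by (metis mult_zero_left)
  then show ?case by blast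
qed

lemma ES_card_zeros:
  assumes "f \<in> ES h" "f \<noteq> (\<lambda>_. 0)" "finite A" "\<forall>t\<in>A. f t = 0"
  shows "card A < length h"
  using ES_eq_zero assms by (meson not_le)

text \<open>Sign rule: each factor of the operator removes the leftmost zero and flips the sign at 0.\<close>
lemma ES_sign:
  assumes "f \<in> ES (h @ [b])" "f \<noteq> (\<lambda>_. 0)" "finite A" "card A = length h"
    "\<forall>t\<in>A. f t = 0 \<and> 0 < t"
  shows "0 < f 0 * ops h f 0 * (- 1) ^ length h"
  using assms
proof (induction h arbitrary: f A)
  case Nil
  have "f 0 \<noteq> 0"
    using ES_card_zeros[OF Nil(1,2), of "{0}"] by auto
  then have "0 < f 0 \<or> f 0 < 0" by linarith
  then show ?case by (auto simp: zero_less_mult_iff)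
next
  case (Cons a h)
  define F where "F = dop a f"
  have f: "smooth f" and F: "F \<in> ES (h @ [b])" using Cons.prems(1) by (auto simp: ES_Cons F_def)
  have "0 \<notin> A" using Cons.prems by auto
  have f0: "f 0 \<noteq> 0"
  proof
    assume "f 0 = 0"
    then have "\<forall>t\<in>insert 0 A. f t = 0" using Cons.prems by auto
    from ES_card_zeros[OF Cons.prems(1,2) _ this] show False
      using Cons.prems \<open>0 \<notin> A\<close> by simp
  qed
  define z where "z = Min A"
  have "A \<noteq> {}" using Cons.prems by auto
  then have z: "z \<in> A" using Cons.prems by (simp add: z_def)
  then have z0: "0 < z" "f z = 0" using Cons.prems by auto
  obtain B where B: "finite B" "card B = length h" "\<forall>t\<in>B. F t = 0 \<and> z < t"
    using Rolle_dop[OF f Cons.prems(3), of "length h" a] Cons.prems unfolding F_def z_def by auto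
  have "((\<lambda>t. exp (a * t) * f t) has_real_derivative exp (a * t) * F t) (at t)" for t
    by (auto intro!: derivative_eq_intros smooth_DERIV[OF f] simp: F_def dop_def algebra_simps)
  \<comment> \<open>On the way from 0 to the leftmost zero \<open>z\<close>, the function
    \<open>exp (a * t) * f t\<close> goes from \<open>f 0\<close> to 0, so \<open>F\<close> has the
    sign opposite to \<open>f 0\<close> at some \<open>x\<close> in between.\<close>
  from MVT2[OF z0(1) this] obtain x where x: "0 < x" "x < z" "- f 0 = z * (exp (a * x) * F x)"
    using z0 by auto
  then have Fx: "f 0 * F x < 0"
  proof -
    have "f 0 * (z * exp (a * x) * F x) < 0" using x(3) f0
      by (metis mult.assoc mult_minus_right neg_less_0_iff_less not_real_square_gt_zero)
    then have "(z * exp (a * x)) * (f 0 * F x) < 0" by (simp add: mult_ac)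
    then show ?thesis using z0 by (simp add: mult_less_0_iff)
  qed
  then have Fne: "F \<noteq> (\<lambda>_. 0)" by auto
  \<comment> \<open>A zero of \<open>F\<close> in \<open>{0..x}\<close>, added to the
    \<open>length h\<close> zeros beyond \<open>z\<close>, would reach the dimension. Hence
    \<open>F\<close> keeps its sign on \<open>{0..x}\<close>.\<close>
  have nz: "F t \<noteq> 0" if "t \<in> {0..x}" for t
  proof
    assume "F t = 0"
    then have 1: "\<forall>t\<in>insert t B. F t = 0" using B by auto
    have "t \<notin> B" using B(3) that x by auto
    then show False using ES_card_zeros[OF F Fne _ 1] B by simp
  qed
  have "0 < F 0 * F x"
  proof (rule ccontr)
    assume n: "\<not> 0 < F 0 * F x"
    have cont: "continuous_on {0..x} F"
      by (rule smooth_continuous[OF ES_smooth[OF F]])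
    have "\<exists>t\<in>{0..x}. F t = 0"
    proof (cases "F 0 \<le> 0")
      case True
      then have "F x \<ge> 0" using n nz[of 0] x by (auto simp: zero_less_mult_iff not_less)
      then show ?thesis using IVT'[of F 0 0 x] True cont x by auto
    next
      case False
      then have "F x \<le> 0" using n by (auto simp: zero_less_mult_iff)
      then show ?thesis using IVT2'[of F x 0 0] False cont x by auto
    qed
    then show False using nz by blast
  qed
  then have "f 0 * F 0 < 0" using Fx
    by (smt (verit) mult_less_0_iff zero_less_mult_iff)
  moreover have "0 < F 0 * ops h F 0 * (- 1) ^ length h"
    using B z0 by (intro Cons.IH[OF F Fne B(1,2)]) (auto intro: less_trans)
  ultimately show ?case
    unfolding ops_simps F_def[symmetric]
    by (auto simp: zero_less_mult_iff mult_less_0_iff)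
qed

subsection \<open>Exponential polynomials\<close>

text \<open>The polynomial factor is general because \<open>dop\<close> does not preserve the form
  monomial times exponential.\<close>

definition exp_poly :: "real poly \<Rightarrow> real \<Rightarrow> real \<Rightarrow> real" where
  "exp_poly q b = (\<lambda>t. poly q t * exp (- b * t))"

lemma exp_poly_DERIV:
  "(exp_poly q b has_real_derivative exp_poly (pderiv q - smult b q) b t) (at t)"
  unfolding exp_poly_def
  by (auto intro!: derivative_eq_intros poly_DERIV simp: algebra_simps)

lemma deriv_exp_poly: "deriv (exp_poly q b) = exp_poly (pderiv q - smult b q) b"
  by (rule ext) (rule DERIV_imp_deriv[OF exp_poly_DERIV])

lemma smooth_exp_poly: "smooth (exp_poly q b)"
proof -
  have "(deriv ^^ k) (exp_poly q b) = exp_poly (((\<lambda>q. pderiv q - smult b q) ^^ k) q) b" for k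
    by (induction k) (auto simp: deriv_exp_poly)
  then show ?thesis
    unfolding smooth_def using exp_poly_DERIV real_differentiable_def by metis
qed

lemma dop_exp_poly: "dop a (exp_poly q b) = exp_poly (pderiv q + smult (a - b) q) b"
  unfolding dop_def deriv_exp_poly by (auto simp: exp_poly_def algebra_simps)

lemma degree_pderiv_add_smult:
  fixes q :: "real poly"
  assumes "c \<noteq> 0"
  shows "degree (pderiv q + smult c q) = degree q"
proof (cases "degree q = 0")
  case True
  then have "pderiv q = 0" by (simp add: pderiv_eq_0_iff)
  then show ?thesis using assms by simp
next
  case False
  then have "degree (pderiv q) < degree (smult c q)" using assms by (simp add: degree_pderiv)
  then show ?thesis using assms by (simp add: degree_add_eq_right)
qed

text \<open>Factors with \<open>a = b\<close> lower the degree by one, and kill a constant; the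
  other factors keep the degree.\<close>

lemma ops_exp_poly_eq_zero:
  "degree q < count_list h b \<Longrightarrow> ops h (exp_poly q b) = (\<lambda>_. 0)"
proof (induction h arbitrary: q)
  case (Cons a h)
  show ?case
  proof (cases "a = b")
    case True
    show ?thesis
    proof (cases "degree q = 0")
      case True
      then have "pderiv q = 0" by (simp add: pderiv_eq_0_iff)
      then have "dop a (exp_poly q b) = (\<lambda>_. 0)"
        unfolding dop_exp_poly using \<open>a = b\<close> by (simp add: exp_poly_def)
      then show ?thesis by (simp add: ops_zero)
    next
      case False
      then show ?thesis
        using Cons.IH[of "pderiv q"] Cons.prems \<open>a = b\<close> by (auto simp: dop_exp_poly degree_pderiv)
    qed
  next
    case False
    then show ?thesis
      using Cons.IH[of "pderiv q + smult (a - b) q"] Cons.prems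
      by (auto simp: dop_exp_poly degree_pderiv_add_smult)
  qed
qed simp

text \<open>The borderline case of the same count: the factors equal to \<open>b\<close> use up the
  degree exactly and leave a nonzero constant.\<close>

lemma ops_exp_poly_degree:
  "q \<noteq> 0 \<Longrightarrow> degree q = count_list h b \<Longrightarrow>
    \<exists>r. r \<noteq> 0 \<and> degree r = 0 \<and> ops h (exp_poly q b) = exp_poly r b"
proof (induction h arbitrary: q)
  case Nil
  then show ?case by auto
next
  case (Cons a h)
  let ?q = "pderiv q + smult (a - b) q"
  have "?q \<noteq> 0 \<and> degree ?q = count_list h b"
  proof (cases "a = b")
    case True
    then show ?thesis using Cons.prems by (auto simp: degree_pderiv pderiv_eq_0_iff)
  next
    case False
    have "degree ?q = degree q" using False by (simp add: degree_pderiv_add_smult)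
    moreover have "?q \<noteq> 0"
    proof (cases "degree q = 0")
      case True
      then have "pderiv q = 0" by (simp add: pderiv_eq_0_iff)
      then show ?thesis using False Cons.prems by simp
    next
      case False
      then show ?thesis using \<open>degree ?q = degree q\<close> by auto
    qed
    ultimately show ?thesis using False Cons.prems by simp
  qed
  then show ?case using Cons.IH[of ?q] by (simp add: dop_exp_poly)
qed

section \<open>Identification of the kernel with the span of exponential monomials\<close>

lemma monomial_exp_poly:
  "(\<lambda>t. t ^ m * exp (- b * t)) = exp_poly (monom 1 m) b"
  by (auto simp: exp_poly_def poly_monom)

lemma new_basis_element:
  fixes h b
  defines "e \<equiv> (\<lambda>t. t ^ count_list h b * exp (- b * t))"
  shows "e \<in> ES (h @ [b])" "ops h e 0 \<noteq> 0"
proof -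
  have e: "e = exp_poly (monom 1 (count_list h b)) b"
    by (simp only: e_def monomial_exp_poly)
  show "e \<in> ES (h @ [b])"
    using ops_exp_poly_eq_zero[of "monom 1 (count_list h b)" "h @ [b]" b]
    by (simp add: ES_def e smooth_exp_poly degree_monom_eq del: ops_simps)
  obtain r where "r \<noteq> 0" "degree r = 0" "ops h e = exp_poly r b"
    using ops_exp_poly_degree[of "monom 1 (count_list h b)" h b]
    by (auto simp: e degree_monom_eq monom_eq_0_iff)
  then show "ops h e 0 \<noteq> 0"
    by (auto simp: exp_poly_def elim!: degree_eq_zeroE)
qed

lemma ES_snoc:
  "f \<in> ES (h @ [b]) \<longleftrightarrow>
    (\<exists>g\<in>ES h. \<exists>c. f = (\<lambda>t. g t + c * (t ^ count_list h b * exp (- b * t))))"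
proof
  define e where "e = (\<lambda>t. t ^ count_list h b * exp (- b * t))"
  have e: "e \<in> ES (h @ [b])" "ops h e 0 \<noteq> 0"
    unfolding e_def by (rule new_basis_element)+
  {
    assume f: "f \<in> ES (h @ [b])"
    \<comment> \<open>Both \<open>ops h f\<close> and \<open>ops h e\<close> are multiples of
      \<open>exp (- b * t)\<close>; this \<open>c\<close> makes them cancel, so that
      \<open>f - c e\<close> lies in the smaller space.\<close>
    define c where "c = ops h f 0 / ops h e 0"
    define g where "g = (\<lambda>t. 1 * f t + (- c) * e t)"
    have s: "smooth f" "smooth e" using f e ES_smooth by auto
    have "ops h g t = 0" for t
      using ES_snocD[OF f, THEN fun_cong, of t] ES_snocD[OF e(1), THEN fun_cong, of t] e(2)
      unfolding g_def ops_lincomb[OF s] by (simp add: c_def)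
    moreover have "smooth g" unfolding g_def by (rule smooth_lincomb[OF s])
    ultimately have "g \<in> ES h" by (auto simp: ES_def)
    then show "\<exists>g\<in>ES h. \<exists>c. f = (\<lambda>t. g t + c * (t ^ count_list h b * exp (- b * t)))"
      by (intro bexI[of _ g] exI[of _ c]) (auto simp: g_def e_def)
  }
  assume "\<exists>g\<in>ES h. \<exists>c. f = (\<lambda>t. g t + c * (t ^ count_list h b * exp (- b * t)))"
  then obtain g c where "g \<in> ES h" "f = (\<lambda>t. g t + c * e t)" unfolding e_def by blast
  then show "f \<in> ES (h @ [b])"
    using ES_lincomb[of g "h @ [b]" e 1 c] ES_snocI e by simp
qed

lemma mult_exp_snoc:
  "i < length h \<Longrightarrow> mult_exp (h @ [b]) i = mult_exp h i"
  "mult_exp (h @ [b]) (length h) = count_list h b"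
proof -
  show "mult_exp (h @ [b]) i = mult_exp h i" if "i < length h"
    unfolding mult_exp_def using that by (intro arg_cong[of _ _ card]) (auto simp: nth_append)
  show "mult_exp (h @ [b]) (length h) = count_list h b"
    unfolding mult_exp_def count_list_eq_length_filter length_filter_conv_card
    by (intro arg_cong[of _ _ card]) (auto simp: nth_append)
qed

lemma P_space_snoc:
  "f \<in> P_space (h @ [b]) \<longleftrightarrow>
    (\<exists>g\<in>P_space h. \<exists>c. f = (\<lambda>t. g t + c * (t ^ count_list h b * exp (- b * t))))"
proof -
  have *: "(\<Sum>i<length (h @ [b]). c i * t ^ mult_exp (h @ [b]) i * exp (- ((h @ [b]) ! i) * t))
      = (\<Sum>i<length h. c i * t ^ mult_exp h i * exp (- (h ! i) * t))
        + c (length h) * (t ^ count_list h b * exp (- b * t))" for c t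
    by (simp add: mult_exp_snoc nth_append)
  show ?thesis
  proof
    assume "f \<in> P_space (h @ [b])"
    then obtain c where
      "f = (\<lambda>t. (\<Sum>i<length h. c i * t ^ mult_exp h i * exp (- (h ! i) * t))
        + c (length h) * (t ^ count_list h b * exp (- b * t)))"
      unfolding P_space_def * by blast
    moreover have "(\<lambda>t. \<Sum>i<length h. c i * t ^ mult_exp h i * exp (- (h ! i) * t)) \<in> P_space h"
      unfolding P_space_def by blast
    ultimately show "\<exists>g\<in>P_space h. \<exists>c. f = (\<lambda>t. g t + c * (t ^ count_list h b * exp (- b * t)))"
      by (intro bexI exI)
  next
    assume "\<exists>g\<in>P_space h. \<exists>c. f = (\<lambda>t. g t + c * (t ^ count_list h b * exp (- b * t)))"
    then obtain c a where
      "f = (\<lambda>t. (\<Sum>i<length h. c i * t ^ mult_exp h i * exp (- (h ! i) * t))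
        + a * (t ^ count_list h b * exp (- b * t)))"
      unfolding P_space_def by blast
    then show "f \<in> P_space (h @ [b])"
      unfolding P_space_def * by (intro CollectI exI[of _ "c(length h := a)"]) auto
  qed
qed

text \<open>Both families obey the same recursion when an exponent is appended, by
  \<open>P_space_snoc\<close> and \<open>ES_snoc\<close>.\<close>

lemma P_space_eq_ES: "P_space h = ES h"
proof (induction h rule: rev_induct)
  case Nil
  show ?case by (auto simp: P_space_def ES_def smooth_zero)
next
  case (snoc b h)
  show ?case
    by (rule set_eqI) (simp only: P_space_snoc ES_snoc snoc)
qed

section \<open>Decay at infinity and boundedness on the half-line\<close>

lemma exp_monomial_tendsto_0:
  fixes b :: real
  assumes "0 < b"
  shows "((\<lambda>t. t ^ m * exp (- b * t)) \<longlongrightarrow> 0) at_top"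
proof -
  have "filterlim (\<lambda>t. b * t) at_top at_top"
    by (rule filterlim_tendsto_pos_mult_at_top[OF tendsto_const assms filterlim_ident])
  from filterlim_compose[OF tendsto_power_div_exp_0[of m] this]
  have "((\<lambda>t. (b * t) ^ m / exp (b * t)) \<longlongrightarrow> 0) at_top" .
  from tendsto_mult_right[OF this, of "1 / b ^ m"]
  show ?thesis using assms
    by (simp add: power_mult_distrib exp_minus field_simps)
qed

lemma ES_tendsto_0:
  "f \<in> ES h \<Longrightarrow> \<forall>x\<in>set h. 0 < x \<Longrightarrow> (f \<longlongrightarrow> 0) at_top"
proof (induction h arbitrary: f rule: rev_induct)
  case Nil
  then show ?case by (simp add: ES_def)
next
  case (snoc b h)
  then obtain g c where g: "g \<in> ES h" and f: "f = (\<lambda>t. g t + c * (t ^ count_list h b * exp (- b * t)))"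
    unfolding ES_snoc by blast
  have "(g \<longlongrightarrow> 0) at_top" using snoc g by auto
  from tendsto_add[OF this tendsto_mult_left[OF exp_monomial_tendsto_0[of b "count_list h b"], of c]]
  show ?case using snoc.prems f by simp
qed

text \<open>Decay bounds the tail and compactness the rest. \<open>K\<close> is positive so that it
  can serve as a divisor.\<close>

lemma ES_bounded:
  assumes "f \<in> ES h" "\<forall>x\<in>set h. 0 < x"
  obtains K where "0 < K" "\<forall>t\<ge>0. \<bar>f t\<bar> \<le> K"
proof -
  have "eventually (\<lambda>t. \<bar>f t\<bar> < 1) at_top"
    using ES_tendsto_0[OF assms] tendsto_rabs_zero order_tendstoD(2)[of "\<lambda>t. \<bar>f t\<bar>" 0 at_top 1] by fastforce
  then obtain R where R: "\<And>t. R \<le> t \<Longrightarrow> \<bar>f t\<bar> < 1" by (auto simp: eventually_at_top_linorder)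
  have "compact (f ` {0..R})"
    using assms ES_smooth smooth_continuous by (intro compact_continuous_image) auto
  then obtain B where B: "\<forall>x\<in>f ` {0..R}. \<bar>x\<bar> \<le> B"
    using compact_imp_bounded bounded_real by metis
  show ?thesis
  proof (rule that[of "max B 1"])
    show "\<forall>t\<ge>0. \<bar>f t\<bar> \<le> max B 1"
    proof (intro allI impI)
      fix t :: real assume "0 \<le> t"
      then show "\<bar>f t\<bar> \<le> max B 1"
        using R[of t] B by (cases "R \<le> t") (auto simp: le_max_iff_disj)
    qed
  qed auto
qed

subsection \<open>Zeros of derivatives and interpolation\<close>

text \<open>Without a zero of the derivative beyond \<open>a\<close>, \<open>f\<close> would be
  injective from \<open>a\<close> on; but a function that starts at 0 and decays to 0 repeats a
  value.\<close>

lemma Rolle_infinity: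
  assumes f: "smooth f" and lim: "(f \<longlongrightarrow> 0) at_top" and a: "f a = 0"
  shows "\<exists>z>a. deriv f z = 0"
proof (rule ccontr)
  assume "\<not> ?thesis"
  then have nz: "deriv f z \<noteq> 0" if "a < z" for z using that by auto
  have ne: "f x \<noteq> f y" if "a \<le> x" and xy: "x < y" for x y
  proof
    assume eq: "f x = f y"
    obtain z where "x < z" "z < y" "f y - f x = (y - x) * deriv f z"
      using MVT2[OF xy smooth_DERIV[OF f]] by auto
    then show False using nz[of z] eq \<open>a \<le> x\<close> by auto
  qed
  define b where "b = a + 1"
  have fb: "f b \<noteq> 0" using ne[of a b] a by (auto simp: b_def)
  have "eventually (\<lambda>t. \<bar>f t\<bar> < \<bar>f b\<bar> \<and> b < t) at_top"
    using order_tendstoD(2)[OF tendsto_rabs_zero[OF lim], of "\<bar>f b\<bar>"] fb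
    by (auto intro: eventually_conj eventually_gt_at_top)
  then obtain c where c: "\<bar>f c\<bar> < \<bar>f b\<bar>" "b < c"
    using eventually_happens'[OF trivial_limit_at_top_linorder] by blast
  have cont: "continuous_on S f" for S by (rule smooth_continuous[OF f])
  \<comment> \<open>If \<open>f c\<close> lies between 0 and \<open>f b\<close>, it is already taken
    between \<open>a\<close> and \<open>b\<close>. If its sign is opposite, \<open>f\<close> has a
    zero between \<open>b\<close> and \<open>c\<close>, which contradicts injectivity since
    \<open>f a = 0\<close>.\<close>
  have "\<exists>x. a \<le> x \<and> x \<le> b \<and> f x = f c"
  proof (cases "0 < f b")
    case True
    then have "f c < f b" using c by linarith
    show ?thesis
    proof (cases "0 \<le> f c")
      case True
      then show ?thesis using IVT'[of f a "f c" b] a \<open>f c < f b\<close> cont by (auto simp: b_def)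
    next
      case False
      then obtain y where "b \<le> y" "y \<le> c" "f y = 0"
        using IVT2'[of f c 0 b] \<open>0 < f b\<close> c cont by auto
      then show ?thesis using ne[of a y] a by (auto simp: b_def)
    qed
  next
    case False
    then have "f b < 0" "f b < f c" using fb c by linarith+
    show ?thesis
    proof (cases "f c \<le> 0")
      case True
      then show ?thesis using IVT2'[of f b "f c" a] a \<open>f b < f c\<close> cont by (auto simp: b_def)
    next
      case False
      then obtain y where "b \<le> y" "y \<le> c" "f y = 0"
        using IVT'[of f b 0 c] \<open>f b < 0\<close> c cont by auto
      then show ?thesis using ne[of a y] a by (auto simp: b_def)
    qed
  qed
  then show False using ne[of _ c] c by force
qed

text \<open>Rolle loses one zero between the points of \<open>A\<close> and regains one at infinity.
  A zero at 0 is traded for a positive one.\<close>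

lemma ES_deriv_zeros:
  assumes f: "f \<in> ES h" "\<forall>x\<in>set h. 0 < x" and A: "finite A" "\<forall>t\<in>A. f t = 0 \<and> 0 \<le> t"
  shows "\<exists>B. finite B \<and> card B = card A \<and> (\<forall>t\<in>B. deriv f t = 0 \<and> 0 < t)"
proof (cases "card A")
  case 0
  then show ?thesis by (intro exI[of _ "{}"]) auto
next
  case (Suc n)
  have s: "smooth f" using f ES_smooth by auto
  have ne: "A \<noteq> {}" using Suc by auto
  have mm: "0 \<le> Min A" "Min A \<le> Max A" "f (Max A) = 0"
    using A ne by auto
  obtain B where B: "finite B" "card B = n" "\<forall>t\<in>B. deriv f t = 0 \<and> Min A < t \<and> t < Max A"
    using Rolle_dop[OF s A(1) Suc, of 0] A by (auto simp: dop_0)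
  obtain z where z: "Max A < z" "deriv f z = 0"
    using Rolle_infinity[OF s ES_tendsto_0[OF f] mm(3)] by auto
  have "z \<notin> B" using B(3) z by auto
  then have "card (insert z B) = card A" using B Suc by simp
  moreover have "deriv f t = 0 \<and> 0 < t" if "t \<in> insert z B" for t
    using that B(3) z mm by auto
  ultimately show ?thesis using B(1) by (intro exI[of _ "insert z B"]) auto
qed

lemma ES_funpow_deriv_zeros:
  assumes f: "f \<in> ES h" "\<forall>x\<in>set h. 0 < x" and A: "finite A" "\<forall>t\<in>A. f t = 0 \<and> 0 < t"
  shows "\<exists>B. finite B \<and> card B = card A \<and> (\<forall>t\<in>B. (deriv ^^ k) f t = 0 \<and> 0 < t)"
proof (induction k)
  case 0
  show ?case using A by (intro exI[of _ A]) auto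
next
  case (Suc k)
  then obtain B where B: "finite B" "card B = card A" "\<forall>t\<in>B. (deriv ^^ k) f t = 0 \<and> 0 < t"
    by blast
  then have "\<forall>t\<in>B. (deriv ^^ k) f t = 0 \<and> 0 \<le> t" by auto
  from ES_deriv_zeros[OF ES_funpow_deriv[OF f(1)] f(2) B(1) this] show ?case using B(2) by simp
qed

text \<open>A vanishing derivative leaves a constant, and a constant that tends to 0 at infinity is
  0.\<close>

lemma ES_funpow_deriv_eq_zero:
  assumes f: "f \<in> ES h" "\<forall>x\<in>set h. 0 < x" and 0: "(deriv ^^ k) f = (\<lambda>_. 0)"
  shows "f = (\<lambda>_. 0)"
  using 0
proof (induction k)
  case (Suc k)
  let ?g = "(deriv ^^ k) f"
  have g: "?g \<in> ES h" by (rule ES_funpow_deriv[OF f(1)])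
  have "?g t = ?g 0" for t
    using DERIV_isconst_all[of ?g t 0] smooth_DERIV[OF ES_smooth[OF g]] Suc.prems by simp
  then have "?g = (\<lambda>_. ?g 0)" by blast
  then have "((\<lambda>_::real. ?g 0) \<longlongrightarrow> 0) at_top" using ES_tendsto_0[OF g f(2)] by metis
  then have "?g 0 = 0" by (simp add: tendsto_const_iff)
  then have "?g = (\<lambda>_. 0)" using \<open>?g = (\<lambda>_. ?g 0)\<close> by metis
  then show ?case by (rule Suc.IH)
qed simp

text \<open>The zeros pass to the \<open>k\<close>-th derivative without loss, and the origin is one
  more. The first differentiation moves all zeros off 0, which is why \<open>k\<close> is at least
  1.\<close>

lemma ES_eq_zero_deriv:
  assumes f: "f \<in> ES h" "\<forall>x\<in>set h. 0 < x" and A: "finite A" "\<forall>t\<in>A. f t = 0 \<and> 0 \<le> t"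
    and k: "1 \<le> k" and c: "length h \<le> Suc (card A)" and 0: "(deriv ^^ k) f 0 = 0"
  shows "f = (\<lambda>_. 0)"
proof -
  obtain j where j: "k = Suc j" using k by (cases k) auto
  obtain C where C: "finite C" "card C = card A" "\<forall>t\<in>C. deriv f t = 0 \<and> 0 < t"
    using ES_deriv_zeros[OF f A] by auto
  obtain B where B: "finite B" "card B = card A" "\<forall>t\<in>B. (deriv ^^ k) f t = 0 \<and> 0 < t"
    using ES_funpow_deriv_zeros[OF ES_deriv[OF f(1)] f(2) C(1,3), of j] C(2)
    unfolding j funpow_Suc_right comp_apply by auto
  have "0 \<notin> B" using B by auto
  then have "length h \<le> card (insert 0 B)" using B c by simp
  moreover have "\<forall>t\<in>insert 0 B. (deriv ^^ k) f t = 0" using B 0 by auto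
  ultimately have "(deriv ^^ k) f = (\<lambda>_. 0)"
    using ES_eq_zero[OF ES_funpow_deriv[OF f(1)]] B(1) by blast
  then show ?thesis by (rule ES_funpow_deriv_eq_zero[OF f])
qed

section \<open>Interpolation in the kernel\<close>

text \<open>Newton's scheme: interpolate in the smaller space at all nodes but one, then correct the
  last value by a function \<open>u\<close> that vanishes at the other nodes.\<close>

lemma ES_interpolation:
  assumes "finite A" "card A = length h"
  shows "\<exists>f\<in>ES h. \<forall>t\<in>A. f t = y t"
  using assms
proof (induction h arbitrary: A y rule: rev_induct)
  case Nil
  then show ?case using ES_zero by auto
next
  case (snoc b h)
  obtain x B where x: "A = insert x B" "x \<notin> B" "finite B" "card B = length h"
    using snoc.prems by (metis card_Suc_eq_finite length_append_singleton)
  define e where "e = (\<lambda>t. t ^ count_list h b * exp (- b * t))"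
  have e: "e \<in> ES (h @ [b])" "ops h e 0 \<noteq> 0"
    unfolding e_def by (rule new_basis_element)+
  obtain f where f: "f \<in> ES h" "\<forall>t\<in>B. f t = e t" using snoc.IH x by blast
  define u where "u = (\<lambda>t. e t - f t)"
  have u: "u \<in> ES (h @ [b])" unfolding u_def using e f ES_diff ES_snocI by blast
  have "u \<noteq> (\<lambda>_. 0)"
  proof
    assume "u = (\<lambda>_. 0)"
    then have "e = f" by (auto simp: u_def fun_eq_iff)
    then show False using f e by (auto simp: ES_def)
  qed
  then have ux: "u x \<noteq> 0"
    using ES_eq_zero[OF u, of A] snoc.prems x f by (auto simp: u_def)
  obtain g where g: "g \<in> ES h" "\<forall>t\<in>B. g t = y t" using snoc.IH x by blast
  define c where "c = (y x - g x) / u x"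
  have "(\<lambda>t. g t + c * u t) \<in> ES (h @ [b])"
    using ES_lincomb[OF ES_snocI[OF g(1)] u, of 1 c] by simp
  moreover have "\<forall>t\<in>A. g t + c * u t = y t"
    using x g f ux by (auto simp: u_def c_def)
  ultimately show ?case by (intro bexI)
qed

text \<open>With one node fewer than the dimension, a nonzero \<open>u\<close> vanishing on
  \<open>A\<close> is available; its \<open>k\<close>-th derivative at 0 is nonzero, so a multiple
  of it cancels that of an interpolant.\<close>

lemma ES_interpolation_deriv:
  assumes h: "\<forall>x\<in>set h. 0 < x" and A: "finite A" "\<forall>t\<in>A. 0 \<le> t" "Suc (card A) = length h"
    and k: "1 \<le> k"
  shows "\<exists>f\<in>ES h. (\<forall>t\<in>A. f t = y t) \<and> (deriv ^^ k) f 0 = 0"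
proof -
  \<comment> \<open>An arbitrary auxiliary node that fills up the dimension.\<close>
  obtain x where x: "x \<notin> A" using A(1) ex_new_if_finite infinite_UNIV_char_0 by blast
  have c: "card (insert x A) = length h" using x A by simp
  obtain f where f: "f \<in> ES h" "\<forall>t\<in>A. f t = y t"
    using ES_interpolation[OF _ c, of y] A(1) by auto
  obtain u where u: "u \<in> ES h" "\<forall>t\<in>insert x A. u t = (if t = x then 1 else 0)"
    using ES_interpolation[OF _ c, of "\<lambda>t. if t = x then 1 else 0"] A(1) by blast
  have uA: "\<forall>t\<in>A. u t = 0 \<and> 0 \<le> t" using u x A by auto
  have "u \<noteq> (\<lambda>_. 0)" using u by auto
  then have uk: "(deriv ^^ k) u 0 \<noteq> 0"
    using ES_eq_zero_deriv[OF u(1) h A(1) uA k] A(3) by auto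
  define c where "c = - (deriv ^^ k) f 0 / (deriv ^^ k) u 0"
  have "(deriv ^^ k) (\<lambda>t. 1 * f t + c * u t) 0 = 0"
    unfolding funpow_deriv_lincomb[OF ES_smooth[OF f(1)] ES_smooth[OF u(1)]]
    using uk by (simp add: c_def)
  then show ?thesis
    using ES_lincomb[OF f(1) u(1), of 1 c] f(2) uA
    by (intro bexI[of _ "\<lambda>t. 1 * f t + c * u t"]) auto
qed

lemma ES_shift:
  assumes "f \<in> ES h"
  shows "(\<lambda>t. f (t + s)) \<in> ES h"
    and "(deriv ^^ k) (\<lambda>t. f (t + s)) = (\<lambda>t. (deriv ^^ k) f (t + s))"
proof -
  have D: "deriv (\<lambda>t. g (t + s)) = (\<lambda>t. deriv g (t + s))" if "smooth g" for g
    using smooth_DERIV[OF that] by (intro ext DERIV_imp_deriv) (simp add: DERIV_shift[symmetric])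
  have K: "(deriv ^^ k) (\<lambda>t. g (t + s)) = (\<lambda>t. (deriv ^^ k) g (t + s))" if "smooth g" for g k
    by (induction k) (simp_all add: D smooth_funpow_deriv that)
  have S: "smooth (\<lambda>t. g (t + s))" if "smooth g" for g
    unfolding smooth_def K[OF that]
    using smooth_DERIV[OF smooth_funpow_deriv[OF that]]
    by (metis DERIV_shift real_differentiable_def)
  have O: "ops h (\<lambda>t. g (t + s)) = (\<lambda>t. ops h g (t + s))" if "smooth g" for g
    using that
  proof (induction h arbitrary: g)
    case (Cons a h)
    have "dop a (\<lambda>t. g (t + s)) = (\<lambda>t. dop a g (t + s))"
      by (simp add: dop_def D Cons.prems)
    then show ?case using Cons smooth_dop by simp
  qed simp
  show "(\<lambda>t. f (t + s)) \<in> ES h" using assms S O by (simp add: ES_def)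
  show "(deriv ^^ k) (\<lambda>t. f (t + s)) = (\<lambda>t. (deriv ^^ k) f (t + s))"
    using K assms ES_smooth by blast
qed

lemma ES_snoc_ops: "f \<in> ES (h @ [b]) \<Longrightarrow> ops h f = exp_poly [:ops h f 0:] b"
  by (subst ES_snocD) (simp_all add: exp_poly_def)

text \<open>\<open>ES_sign\<close> applied to the \<open>k\<close>-th derivative, whose coefficient
  of \<open>exp (- b * t)\<close> gains the factor \<open>(- b) ^ k\<close>. The hypothesis concerns
  zeros of the first derivative because extremal points provide those.\<close>

lemma ES_sign_funpow_deriv:
  assumes f: "f \<in> ES (h @ [b])" "\<forall>x\<in>set (h @ [b]). 0 < x" "f \<noteq> (\<lambda>_. 0)"
    and A: "finite A" "card A = length h" "\<forall>t\<in>A. deriv f t = 0 \<and> 0 < t" and k: "1 \<le> k"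
  shows "0 < (deriv ^^ k) f 0 * ((- b) ^ k * ops h f 0) * (- 1) ^ length h"
proof -
  obtain j where j: "k = Suc j" using k by (cases k) auto
  obtain B where B: "finite B" "card B = card A" "\<forall>t\<in>B. (deriv ^^ k) f t = 0 \<and> 0 < t"
    using ES_funpow_deriv_zeros[OF ES_deriv[OF f(1)] f(2) A(1,3), of j]
    unfolding j funpow_Suc_right comp_apply by auto
  have "(deriv ^^ k) f \<noteq> (\<lambda>_. 0)" using ES_funpow_deriv_eq_zero[OF f(1,2)] f(3) by blast
  from ES_sign[OF ES_funpow_deriv[OF f(1)] this B(1) _ B(3)]
  have *: "0 < (deriv ^^ k) f 0 * ops h ((deriv ^^ k) f) 0 * (- 1) ^ length h"
    using A B by simp
  have e: "ops h f = exp_poly [:ops h f 0:] b"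
    by (rule ES_snoc_ops[OF f(1)])
  have "(deriv ^^ k) (exp_poly [:c:] b) = exp_poly [:(- b) ^ k * c:] b" for c
    by (induction k) (simp_all add: deriv_exp_poly mult.assoc)
  then have "(deriv ^^ k) (ops h f) = exp_poly [:(- b) ^ k * ops h f 0:] b"
    using e by metis
  then have "ops h ((deriv ^^ k) f) 0 = (- b) ^ k * ops h f 0"
    using ops_funpow_deriv[OF ES_smooth[OF f(1)]] by (simp add: exp_poly_def)
  then show ?thesis using * by simp
qed

subsection \<open>Extremal functions\<close>

text \<open>Compactness in coordinates: a function is encoded by its values at the nodes 0, ..., n -
  1, in which the functional is linear and continuous.\<close>

lemma ES_maximizer_exists:
  assumes h: "\<forall>x\<in>set h. 0 < x"
  shows "\<exists>T\<in>ES h. (\<forall>t\<ge>0. \<bar>T t\<bar> \<le> 1) \<and>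
    (\<forall>p\<in>ES h. (\<forall>t\<ge>0. \<bar>p t\<bar> \<le> 1) \<longrightarrow> (deriv ^^ k) p 0 \<le> (deriv ^^ k) T 0)"
proof -
  define n where "n = length h"
  define X where "X = real ` {..<n}"
  have X: "finite X" "card X = n" by (auto simp: X_def card_image)
  have "\<forall>i. \<exists>f. f \<in> ES h \<and> (\<forall>t\<in>X. f t = (if t = real i then 1 else 0))"
  proof
    fix i show "\<exists>f. f \<in> ES h \<and> (\<forall>t\<in>X. f t = (if t = real i then 1 else 0))"
      using ES_interpolation[OF X(1), of h "\<lambda>t. if t = real i then 1 else 0"] X(2)
      by (auto simp: n_def)
  qed
  from choice[OF this] obtain l
    where l: "\<And>i. l i \<in> ES h" "\<And>i t. t \<in> X \<Longrightarrow> l i t = (if t = real i then 1 else 0)"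
    by blast
  define L where "L = (\<lambda>(a :: nat \<Rightarrow> real) t. \<Sum>i<n. a i * l i t)"
  have L: "L a \<in> ES h" "(deriv ^^ k) (L a) 0 = (\<Sum>i<n. a i * (deriv ^^ k) (l i) 0)" for a
    unfolding L_def using ES_sum(1)[of n l h a] ES_sum(2)[of n l h k a] l(1) by simp_all
  have rep: "L (\<lambda>i. p (real i)) = p" if p: "p \<in> ES h" for p
  proof -
    have "L (\<lambda>i. p (real i)) (real j) - p (real j) = 0" if "j < n" for j
    proof -
      have "p (real i) * l i (real j) = (if i = j then p (real j) else 0)" for i
        using l(2)[of "real j" i] that by (auto simp: X_def)
      then show ?thesis using that by (simp add: L_def)
    qed
    then have "\<forall>t\<in>X. L (\<lambda>i. p (real i)) t - p t = 0" unfolding X_def by blast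
    then have "(\<lambda>t. L (\<lambda>i. p (real i)) t - p t) = (\<lambda>_. 0)"
      using ES_eq_zero[OF ES_diff[OF L(1) p] X(1)] X(2) n_def by simp
    then show ?thesis by (metis (no_types) ext eq_iff_diff_eq_0)
  qed
  \<comment> \<open>Admissible functions have node values between -1 and 1, so the encodings lie in
    a cube that is compact by Tychonoff, and the norm condition is closed.\<close>
  define C where "C = (PiE UNIV (\<lambda>_ :: nat. {-1..1 :: real})) \<inter> (\<Inter>t\<in>{0..}. {a. \<bar>L a t\<bar> \<le> 1})"
  have "compact (PiE UNIV (\<lambda>_ :: nat. {-1..1 :: real}))"
    using compactin_PiE[of "\<lambda>_. euclidean" UNIV "\<lambda>_ :: nat. {-1..1 :: real}"]
    by (simp add: euclidean_product_topology)
  moreover have "closed (\<Inter>t\<in>{0..}. {a. \<bar>L a t\<bar> \<le> 1})"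
    unfolding L_def
    by (intro closed_INT ballI closed_Collect_le continuous_intros) auto
  ultimately have "compact C" unfolding C_def by (rule compact_Int_closed)
  moreover have "(\<lambda>_. 0) \<in> C" by (auto simp: C_def L_def)
  moreover have "continuous_on C (\<lambda>a. \<Sum>i<n. a i * (deriv ^^ k) (l i) 0)"
    by (intro continuous_intros continuous_on_subset[OF continuous_on_product_coordinates]) auto
  ultimately obtain a where a: "a \<in> C"
    "\<And>a'. a' \<in> C \<Longrightarrow> (\<Sum>i<n. a' i * (deriv ^^ k) (l i) 0) \<le> (\<Sum>i<n. a i * (deriv ^^ k) (l i) 0)"
    using continuous_attains_sup[of C "\<lambda>a. \<Sum>i<n. a i * (deriv ^^ k) (l i) 0"] by blast
  show ?thesis
  proof (intro bexI[of _ "L a"] conjI ballI impI)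
    show "\<forall>t\<ge>0. \<bar>L a t\<bar> \<le> 1" using a(1) by (auto simp: C_def)
    show "L a \<in> ES h" by (rule L)
    fix p assume p: "p \<in> ES h" "\<forall>t\<ge>0. \<bar>p t\<bar> \<le> 1"
    then have "(\<lambda>i. p (real i)) \<in> C"
      using rep[OF p(1)] by (auto simp: C_def PiE_iff abs_le_iff minus_le_iff)
    from a(2)[OF this] show "(deriv ^^ k) p 0 \<le> (deriv ^^ k) (L a) 0"
      using L(2)[of "\<lambda>i. p (real i)"] L(2)[of a] rep[OF p(1)] by simp
  qed
qed

lemma supnorm_le_iff:
  assumes "f \<in> ES h" "\<forall>x\<in>set h. 0 < x"
  shows "supnorm_Rplus f \<le> c \<longleftrightarrow> (\<forall>t\<ge>0. \<bar>f t\<bar> \<le> c)"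
proof -
  obtain K where "\<forall>t\<ge>0. \<bar>f t\<bar> \<le> K" using ES_bounded[OF assms] by blast
  then have "bdd_above ((\<lambda>t. \<bar>f t\<bar>) ` {0..})" by (auto intro!: bdd_aboveI)
  then show ?thesis unfolding supnorm_Rplus_def by (subst cSUP_le_iff) auto
qed

text \<open>A maximizer normalized in sign and position, which spares absolute values in the
  perturbation arguments.\<close>

definition extremal :: "nat \<Rightarrow> real list \<Rightarrow> (real \<Rightarrow> real) \<Rightarrow> bool" where
  "extremal k h T \<longleftrightarrow> T \<in> ES h \<and> (\<forall>t\<ge>0. \<bar>T t\<bar> \<le> 1) \<and> (deriv ^^ k) T 0 = M k h"

text \<open>By translation invariance the supremum in M is attained at the origin.\<close>
lemma extremal_exists:
  assumes h: "\<forall>x\<in>set h. 0 < x"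
  shows "\<exists>T. extremal k h T"
    and "p \<in> ES h \<Longrightarrow> \<forall>t\<ge>0. \<bar>p t\<bar> \<le> 1 \<Longrightarrow> (deriv ^^ k) p 0 \<le> M k h"
proof -
  obtain T where T: "T \<in> ES h" "\<forall>t\<ge>0. \<bar>T t\<bar> \<le> 1"
    "\<And>p. p \<in> ES h \<Longrightarrow> \<forall>t\<ge>0. \<bar>p t\<bar> \<le> 1 \<Longrightarrow> (deriv ^^ k) p 0 \<le> (deriv ^^ k) T 0"
    using ES_maximizer_exists[OF h, of k] by blast
  have le: "supnorm_Rplus ((deriv ^^ k) p) \<le> (deriv ^^ k) T 0"
    if p: "p \<in> ES h" "\<forall>t\<ge>0. \<bar>p t\<bar> \<le> 1" for p
    unfolding supnorm_le_iff[OF ES_funpow_deriv[OF p(1)] h]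
  proof (intro allI impI)
    fix s :: real assume s: "0 \<le> s"
    \<comment> \<open>The shift moves the point \<open>s\<close> to the origin; comparing
      \<open>T\<close> with both \<open>q\<close> and \<open>- q\<close> bounds the absolute
      value.\<close>
    define q where "q = (\<lambda>t. p (t + s))"
    have q: "q \<in> ES h" "(deriv ^^ k) q 0 = (deriv ^^ k) p s" "\<forall>t\<ge>0. \<bar>q t\<bar> \<le> 1"
      using ES_shift[OF p(1), where s = s] p(2) s by (auto simp: q_def)
    have m: "(deriv ^^ k) (\<lambda>t. - q t) 0 = - (deriv ^^ k) q 0"
      using funpow_deriv_lincomb[of q q k "-1" 0] ES_smooth[OF q(1)] by simp
    show "\<bar>(deriv ^^ k) p s\<bar> \<le> (deriv ^^ k) T 0"
      using T(3)[OF q(1,3)] T(3)[of "\<lambda>t. - q t"] ES_scale[OF q(1), of "-1"] q m by auto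
  qed
  have ge: "(deriv ^^ k) T 0 \<le> supnorm_Rplus ((deriv ^^ k) T)"
    using supnorm_le_iff[OF ES_funpow_deriv[OF T(1)] h, of k] abs_ge_self order_trans by blast
  have "M k h = (deriv ^^ k) T 0"
    unfolding M_def P_space_eq_ES
  proof (rule cSup_eq_maximum)
    have "supnorm_Rplus T \<le> 1" using supnorm_le_iff[OF T(1) h] T(2) by blast
    moreover have "(deriv ^^ k) T 0 = supnorm_Rplus ((deriv ^^ k) T)"
      using ge le[OF T(1,2)] by simp
    ultimately show "(deriv ^^ k) T 0 \<in> {supnorm_Rplus ((deriv ^^ k) p) |p. p \<in> ES h \<and> supnorm_Rplus p \<le> 1}"
      using T(1) by blast
  next
    fix x assume "x \<in> {supnorm_Rplus ((deriv ^^ k) p) |p. p \<in> ES h \<and> supnorm_Rplus p \<le> 1}"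
    then show "x \<le> (deriv ^^ k) T 0" using le supnorm_le_iff[OF _ h] by blast
  qed
  then show "\<exists>T. extremal k h T" "p \<in> ES h \<Longrightarrow> \<forall>t\<ge>0. \<bar>p t\<bar> \<le> 1 \<Longrightarrow> (deriv ^^ k) p 0 \<le> M k h"
    using T by (auto simp: extremal_def)
qed

text \<open>A function with value 1 at 0 that vanishes at the other nodes has nonzero
  \<open>k\<close>-th derivative at 0, by \<open>ES_eq_zero_deriv\<close>; it is then scaled to norm
  at most 1 with the right sign.\<close>

lemma M_pos:
  assumes h: "\<forall>x\<in>set h. 0 < x" "h \<noteq> []" and k: "1 \<le> k"
  shows "0 < M k h"
proof -
  define X where "X = real ` {..<length h}"
  have X: "finite X" "card X = length h" "0 \<in> X" using h(2) by (auto simp: X_def card_image)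
  obtain f where f: "f \<in> ES h" "\<forall>t\<in>X. f t = (if t = 0 then 1 else 0)"
    using ES_interpolation[OF X(1,2), of "\<lambda>t. if t = 0 then 1 else 0"] by blast
  have z: "\<forall>t\<in>X - {0}. f t = 0 \<and> 0 \<le> t" using f by (auto simp: X_def)
  have "f \<noteq> (\<lambda>_. 0)" using f X by auto
  moreover have "length h \<le> Suc (card (X - {0}))" using X by simp
  ultimately have nz: "(deriv ^^ k) f 0 \<noteq> 0"
    using ES_eq_zero_deriv[OF f(1) h(1) _ z k] X(1) by blast
  obtain K where K: "0 < K" "\<forall>t\<ge>0. \<bar>f t\<bar> \<le> K" using ES_bounded[OF f(1) h(1)] by blast
  define c where "c = sgn ((deriv ^^ k) f 0) / K"
  have "\<bar>c * f t\<bar> \<le> 1" if "0 \<le> t" for t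
    using K that nz by (simp add: c_def abs_mult abs_sgn_eq)
  then have "(deriv ^^ k) (\<lambda>t. c * f t) 0 \<le> M k h"
    using extremal_exists(2)[OF h(1) ES_scale[OF f(1)]] by blast
  moreover have "(deriv ^^ k) (\<lambda>t. c * f t) 0 = \<bar>(deriv ^^ k) f 0\<bar> / K"
    using funpow_deriv_lincomb[of f f k c 0] ES_smooth[OF f(1)] by (simp add: c_def abs_sgn)
  moreover have "0 < \<bar>(deriv ^^ k) f 0\<bar> / K" using nz K by simp
  ultimately show ?thesis by linarith
qed

section \<open>Perturbation of maximizers and the number of extremal points\<close>

text \<open>Where \<open>q t * T t\<close> is not well below 0, and in the tail, the modulus of
  \<open>T\<close> stays away from 1, so a small perturbation is harmless. Elsewhere the square of
  the modulus drops to first order in \<open>e\<close>.\<close>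

lemma perturbation_decreases_norm:
  fixes T q :: "real \<Rightarrow> real"
  assumes T: "continuous_on UNIV T" "(T \<longlongrightarrow> 0) at_top" "\<forall>t\<ge>0. \<bar>T t\<bar> \<le> 1"
    and q: "continuous_on UNIV q" "0 < K" "\<forall>t\<ge>0. \<bar>q t\<bar> \<le> K"
    and m: "0 < m" "\<forall>t\<ge>0. \<bar>T t\<bar> = 1 \<longrightarrow> q t * T t \<le> - m"
  shows "\<exists>e>0. \<exists>r. 0 < r \<and> r < 1 \<and> (\<forall>t\<ge>0. \<bar>T t + e * q t\<bar> \<le> r)"
proof -
  have "eventually (\<lambda>t. \<bar>T t\<bar> < 1 / 2) at_top"
    using order_tendstoD(2)[OF tendsto_rabs_zero[OF T(2)], of "1 / 2"] by simp
  then obtain R where R: "\<And>t. R \<le> t \<Longrightarrow> \<bar>T t\<bar> < 1 / 2" by (auto simp: eventually_at_top_linorder)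
  define C where "C = {0..R} \<inter> {t. - (m / 2) \<le> q t * T t}"
  have "compact C" unfolding C_def
    by (intro compact_Int_closed closed_Collect_le continuous_intros T q) auto
  have lt: "\<bar>T t\<bar> < 1" if "t \<in> C" for t
  proof -
    have t: "0 \<le> t" "- (m / 2) \<le> q t * T t" using that by (auto simp: C_def)
    have "\<bar>T t\<bar> \<noteq> 1"
    proof
      assume "\<bar>T t\<bar> = 1"
      then have "q t * T t \<le> - m" using m(2) t by blast
      then show False using m(1) t by linarith
    qed
    then show ?thesis using T(3) t by fastforce
  qed
  have "\<exists>s<1. 1 / 2 \<le> s \<and> (\<forall>t\<in>C. \<bar>T t\<bar> \<le> s)"
  proof (cases "C = {}")
    case True
    then show ?thesis by (intro exI[of _ "1/2"]) auto
  next
    case False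
    have "continuous_on C (\<lambda>t. \<bar>T t\<bar>)"
      by (intro continuous_intros continuous_on_subset[OF T(1)]) auto
    then obtain x where "x \<in> C" "\<forall>t\<in>C. \<bar>T t\<bar> \<le> \<bar>T x\<bar>"
      using continuous_attains_sup[OF \<open>compact C\<close> False] by blast
    then show ?thesis using lt[of x] by (intro exI[of _ "max (1/2) \<bar>T x\<bar>"]) auto
  qed
  then obtain s where s: "s < 1" "1 / 2 \<le> s" "\<And>t. t \<in> C \<Longrightarrow> \<bar>T t\<bar> \<le> s" by blast
  \<comment> \<open>The first bound uses up at most half of the gap \<open>1 - s\<close>; the second
    keeps the quadratic term below half of the linear gain \<open>e * m\<close>.\<close>
  define e where "e = min ((1 - s) / (2 * K)) (m / (2 * K\<^sup>2))"
  have e: "0 < e" using s q m by (simp add: e_def)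
  have eK: "e * K \<le> (1 - s) / 2"
  proof -
    have "e \<le> (1 - s) / (2 * K)" by (simp add: e_def)
    then show ?thesis using q(2) by (simp add: field_simps)
  qed
  have eK2: "e * K\<^sup>2 \<le> m / 2"
  proof -
    have "e \<le> m / (2 * K\<^sup>2)" by (simp add: e_def)
    then show ?thesis using q(2) by (simp add: field_simps)
  qed
  define r where "r = max ((1 + s) / 2) (sqrt (1 - e * m / 2))"
  have "r < 1" using s e m by (simp add: r_def)
  moreover have "0 < r" using s by (simp add: r_def less_max_iff_disj)
  moreover have "\<bar>T t + e * q t\<bar> \<le> r" if t: "0 \<le> t" for t
  proof -
    have eq: "\<bar>e * q t\<bar> \<le> e * K" using q t e by (simp add: abs_mult)
    consider "\<bar>T t\<bar> \<le> s" | "q t * T t < - (m / 2)"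
    proof (cases "R \<le> t \<or> t \<in> C")
      case True
      then have "\<bar>T t\<bar> \<le> s" using s(2) s(3)[of t] R[of t] by linarith
      then show ?thesis using that(1) by blast
    next
      case False
      then have "q t * T t < - (m / 2)" using t by (auto simp: C_def)
      then show ?thesis using that(2) by blast
    qed
    then show ?thesis
    proof cases
      case 1
      then have "\<bar>T t + e * q t\<bar> \<le> (1 + s) / 2"
        using eq eK abs_triangle_ineq[of "T t" "e * q t"] by argo
      then show ?thesis unfolding r_def by linarith
    next
      case 2
      have "(T t)\<^sup>2 \<le> 1" using T(3) t abs_square_le_1 by blast
      moreover have "2 * e * (q t * T t) \<le> - (e * m)"
        using mult_left_mono[of "2 * (q t * T t)" "- m" e] 2 e by simp
      moreover have "(e * q t)\<^sup>2 \<le> e * m / 2"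
      proof -
        have "\<bar>q t\<bar>\<^sup>2 \<le> K\<^sup>2" using q t by (intro power_mono) auto
        then have "e * (e * (q t)\<^sup>2) \<le> e * (e * K\<^sup>2)" using e by simp
        also have "\<dots> \<le> e * (m / 2)" using eK2 e by (intro mult_left_mono) auto
        finally show ?thesis by (simp add: power2_eq_square mult_ac)
      qed
      ultimately have "(T t + e * q t)\<^sup>2 \<le> 1 - e * m / 2"
        by (simp add: power2_sum algebra_simps)
      then have "\<bar>T t + e * q t\<bar> \<le> sqrt (1 - e * m / 2)"
        by (metis real_sqrt_abs real_sqrt_le_mono)
      then show ?thesis by (simp add: r_def)
    qed
  qed
  ultimately show ?thesis using e by blast
qed

text \<open>Otherwise \<open>T + e q\<close>, divided by its norm bound \<open>r < 1\<close>, would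
  be admissible with value at least \<open>M k h / r\<close>, which exceeds \<open>M k h\<close> by
  positivity.\<close>

lemma extremal_no_ascent:
  assumes h: "\<forall>x\<in>set h. 0 < x" "h \<noteq> []" and k: "1 \<le> k"
    and T: "extremal k h T" and q: "q \<in> ES h"
    and m: "0 < m" "\<forall>t\<ge>0. \<bar>T t\<bar> = 1 \<longrightarrow> q t * T t \<le> - m"
  shows "(deriv ^^ k) q 0 < 0"
proof (rule ccontr)
  assume n: "\<not> ?thesis"
  have T': "T \<in> ES h" "\<forall>t\<ge>0. \<bar>T t\<bar> \<le> 1" "(deriv ^^ k) T 0 = M k h"
    using T by (auto simp: extremal_def)
  obtain K where K: "0 < K" "\<forall>t\<ge>0. \<bar>q t\<bar> \<le> K" using ES_bounded[OF q h(1)] by blast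
  obtain e r where e: "0 < e" "0 < r" "r < 1" "\<forall>t\<ge>0. \<bar>T t + e * q t\<bar> \<le> r"
    using perturbation_decreases_norm[OF smooth_continuous[OF ES_smooth[OF T'(1)]]
      ES_tendsto_0[OF T'(1) h(1)] T'(2) smooth_continuous[OF ES_smooth[OF q]] K m] by blast
  define p where "p = (\<lambda>t. (1 / r) * T t + (e / r) * q t)"
  have "p \<in> ES h" unfolding p_def by (rule ES_lincomb[OF T'(1) q])
  moreover have "\<forall>t\<ge>0. \<bar>p t\<bar> \<le> 1"
  proof (intro allI impI)
    fix t :: real assume "0 \<le> t"
    then have "\<bar>T t + e * q t\<bar> / r \<le> 1" using e by simp
    moreover have "p t = (T t + e * q t) / r" by (simp add: p_def add_divide_distrib)
    ultimately show "\<bar>p t\<bar> \<le> 1" using e by simp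
  qed
  ultimately have "(deriv ^^ k) p 0 \<le> M k h" by (rule extremal_exists(2)[OF h(1)])
  moreover have "(deriv ^^ k) p 0 = (1 / r) * M k h + (e / r) * (deriv ^^ k) q 0"
    unfolding p_def funpow_deriv_lincomb[OF ES_smooth[OF T'(1)] ES_smooth[OF q]] T'(3) ..
  moreover have "0 \<le> (e / r) * (deriv ^^ k) q 0" using e n by simp
  moreover have "M k h < (1 / r) * M k h"
    using e M_pos[OF h k] by (simp add: field_simps)
  ultimately show False by linarith
qed

text \<open>At most \<open>d - 1\<close> points are positive, being zeros of the nonzero function
  \<open>deriv T\<close>, where \<open>d = length h\<close>; fewer than \<open>d\<close> points in
  all would allow a perturbation. Both bounds are sharp, so 0 is extremal too.\<close>

lemma extremal_points:
  assumes h: "\<forall>x\<in>set h. 0 < x" "h \<noteq> []" and k: "1 \<le> k" and T: "extremal k h T"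
  defines "E \<equiv> {t. 0 \<le> t \<and> \<bar>T t\<bar> = 1}"
  shows "finite E" "card E = length h" "Suc (card (E - {0})) = length h"
    "\<forall>t\<in>E - {0}. deriv T t = 0 \<and> 0 < t"
proof -
  have T': "T \<in> ES h" "\<forall>t\<ge>0. \<bar>T t\<bar> \<le> 1" "(deriv ^^ k) T 0 = M k h"
    using T by (auto simp: extremal_def)
  have s: "smooth T" using T' ES_smooth by blast
  have "(deriv ^^ k) T 0 > 0" using T' M_pos[OF h k] by simp
  then have "T \<noteq> (\<lambda>_. 0)" by auto
  then have d: "deriv T \<noteq> (\<lambda>_. 0)" using ES_funpow_deriv_eq_zero[OF T'(1) h(1), of 1] by auto
  show z: "\<forall>t\<in>E - {0}. deriv T t = 0 \<and> 0 < t"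
  proof
    fix t assume "t \<in> E - {0}"
    then have t: "0 < t" "T t = 1 \<or> T t = - 1" by (auto simp: E_def)
    have b: "- 1 \<le> T y \<and> T y \<le> 1" if "\<bar>t - y\<bar> < t" for y
      using T'(2) that by (auto simp: abs_le_iff)
    have "deriv T t = 0"
      using t(2)
    proof
      assume "T t = 1"
      then have "\<forall>y. \<bar>t - y\<bar> < t \<longrightarrow> T y \<le> T t" using b by simp
      then show ?thesis by (rule DERIV_local_max[OF smooth_DERIV[OF s] t(1)])
    next
      assume "T t = - 1"
      then have "\<forall>y. \<bar>t - y\<bar> < t \<longrightarrow> T t \<le> T y" using b by simp
      then show ?thesis by (rule DERIV_local_min[OF smooth_DERIV[OF s] t(1)])
    qed
    then show "deriv T t = 0 \<and> 0 < t" using t by blast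
  qed
  have c: "card F \<le> length h - 1" if "F \<subseteq> E - {0}" "finite F" for F
  proof -
    have "\<forall>t\<in>F. deriv T t = 0" using that z by blast
    then show ?thesis using ES_card_zeros[OF ES_deriv[OF T'(1)] d that(2)] by fastforce
  qed
  then have fin: "finite (E - {0})" "card (E - {0}) \<le> length h - 1"
    using finite_if_finite_subsets_card_bdd[of "E - {0}" "length h - 1"] by blast+
  then show fE: "finite E" by simp
  have "length h \<le> card E"
  proof (rule ccontr)
    assume n: "\<not> length h \<le> card E"
    \<comment> \<open>Extra nodes pad \<open>E\<close> to exactly \<open>d - 1\<close> points, the
      number that \<open>ES_interpolation_deriv\<close> expects.\<close>
    have "infinite ({0 :: real..} - E)" using fE by (simp add: infinite_Ici)
    then obtain B where B: "finite B" "card B = length h - 1 - card E" "B \<subseteq> {0..} - E"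
      using infinite_arbitrarily_large by blast
    define A where "A = E \<union> B"
    have "card A = card E + card B" unfolding A_def using B fE by (intro card_Un_disjoint) auto
    then have A: "finite A" "\<forall>t\<in>A. 0 \<le> t" "Suc (card A) = length h"
      using B fE n by (auto simp: A_def E_def)
    obtain q where q: "q \<in> ES h" "\<forall>t\<in>A. q t = - T t" "(deriv ^^ k) q 0 = 0"
      using ES_interpolation_deriv[OF h(1) A k, of "\<lambda>t. - T t"] by blast
    have "q t * T t \<le> - 1" if "0 \<le> t" "\<bar>T t\<bar> = 1" for t
    proof -
      have "q t = - T t" "T t = 1 \<or> T t = - 1" using q that by (auto simp: A_def E_def)
      then show ?thesis by auto
    qed
    then show False using extremal_no_ascent[OF h k T q(1), of 1] q(3) by auto
  qed
  moreover have "card E \<le> Suc (card (E - {0}))"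
    using fE card_Suc_Diff1[OF fE, of 0] by (cases "0 \<in> E") simp_all
  moreover have "0 < length h" using h by simp
  ultimately show "card E = length h" "Suc (card (E - {0})) = length h"
    using fin by linarith+
qed

subsection \<open>Raising one exponent\<close>

lemma ES_insert: "f \<in> ES (h @ [b]) \<Longrightarrow> f \<in> ES ((h @ [a]) @ [b])"
  by (auto simp: ES_def dop_commute[OF smooth_ops, of _ b a] dop_zero)

lemma M_less_raise_entry:
  assumes g: "\<forall>x\<in>set g. 0 < x" and b: "0 < b" "b < b'" and k: "1 \<le> k"
  shows "M k (g @ [b]) < M k (g @ [b'])"
proof -
  \<comment> \<open>\<open>?h''\<close> contains both exponents, so the difference of elements of
    the two spaces lies in its kernel.\<close>
  let ?h = "g @ [b]" and ?h' = "g @ [b']" and ?h'' = "(g @ [b']) @ [b]"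
  have h: "\<forall>x\<in>set ?h. 0 < x" "?h \<noteq> []" and h': "\<forall>x\<in>set ?h'. 0 < x" "?h' \<noteq> []"
    and h'': "\<forall>x\<in>set ?h''. 0 < x"
    using g b by auto
  obtain T T' where T: "extremal k ?h T" and T': "extremal k ?h' T'"
    using extremal_exists(1) h h' by blast
  have TE: "T \<in> ES ?h" "\<forall>t\<ge>0. \<bar>T t\<bar> \<le> 1" "(deriv ^^ k) T 0 = M k ?h"
    and T'E: "T' \<in> ES ?h'" "(deriv ^^ k) T' 0 = M k ?h'"
    using T T' by (auto simp: extremal_def)
  have pos: "0 < M k ?h" "0 < M k ?h'" using M_pos[OF h k] M_pos[OF h' k] .
  have Tne: "T \<noteq> (\<lambda>_. 0)" using TE pos by auto
  define a where "a = ops g T 0"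
  define X where "X = (- b) ^ k * a * (- 1) ^ length g"
  note pt = extremal_points[OF h k T]
  have "0 < M k ?h * ((- b) ^ k * a) * (- 1) ^ length g"
    using ES_sign_funpow_deriv[OF TE(1) h(1) Tne _ _ pt(4) k] pt(1,3) TE(3) by (simp add: a_def)
  then have X: "0 < X" using pos by (simp add: X_def mult.assoc zero_less_mult_iff)
  then have a: "a \<noteq> 0" by (auto simp: X_def)
  define E where "E = {t. 0 \<le> t \<and> \<bar>T' t\<bar> = 1}"
  have E: "finite E" "card E = length ?h'" using extremal_points[OF h' k T'] by (auto simp: E_def)
  obtain v where v: "v \<in> ES ?h'" "\<forall>t\<in>E. v t = T t"
    using ES_interpolation[OF E, of T] by blast
  define f where "f = (\<lambda>t. 1 * T t + (- 1) * v t)"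
  have f: "f \<in> ES ?h''"
    unfolding f_def using ES_insert[OF TE(1)] ES_snocI[OF v(1)] by (rule ES_lincomb)
  have s: "smooth T" "smooth v" using TE v ES_smooth by auto
  \<comment> \<open>The factor for \<open>b'\<close> kills \<open>v\<close> and multiplies
    \<open>exp (- b * t)\<close> by \<open>b' - b\<close>, which is positive: the coefficient keeps
    its sign.\<close>
  have f0: "ops ?h' f 0 = (b' - b) * a"
  proof -
    have "ops g T = exp_poly [:a:] b"
      unfolding a_def by (rule ES_snoc_ops[OF TE(1)])
    then have "ops ?h' T = exp_poly [:(b' - b) * a:] b"
      by (simp add: dop_exp_poly)
    moreover have "ops ?h' v = (\<lambda>_. 0)" using v by (simp add: ES_def)
    ultimately show ?thesis
      unfolding f_def ops_lincomb[OF s] by (simp add: exp_poly_def del: ops_simps)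
  qed
  have fne: "f \<noteq> (\<lambda>_. 0)"
  proof
    assume "f = (\<lambda>_. 0)"
    then have "ops ?h' f 0 = 0" by (simp only: ops_zero)
    then show False using f0 a b by simp
  qed
  have "\<forall>t\<in>E. f t = 0 \<and> 0 \<le> t" using v by (auto simp: f_def E_def)
  then obtain B where B: "finite B" "card B = card E" "\<forall>t\<in>B. deriv f t = 0 \<and> 0 < t"
    using ES_deriv_zeros[OF f h'' E(1)] by blast
  have "0 < (deriv ^^ k) f 0 * ((- b) ^ k * ops ?h' f 0) * (- 1) ^ length ?h'"
    using ES_sign_funpow_deriv[OF f h'' fne B(1) _ B(3) k] B(2) E(2) by simp
  \<comment> \<open>The exponent of -1 is now \<open>length g + 1\<close>; this single extra sign
    makes the derivative of \<open>f\<close> at 0 negative.\<close>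
  also have "\<dots> = (b' - b) * X * - (deriv ^^ k) f 0"
    unfolding f0 X_def by simp
  finally have "(deriv ^^ k) f 0 < 0"
    using b X by (simp add: zero_less_mult_iff mult_less_0_iff)
  then have gt: "M k ?h < (deriv ^^ k) v 0"
    unfolding f_def funpow_deriv_lincomb[OF s] TE(3) by simp
  have "(deriv ^^ k) v 0 \<le> M k ?h'"
  proof (rule ccontr)
    assume n: "\<not> ?thesis"
    \<comment> \<open>Half the relative excess of \<open>v\<close> over the maximum:
      \<open>v - (1 + c) T'\<close> then opposes \<open>T'\<close> on \<open>E\<close>, where the
      modulus of \<open>v\<close> is at most 1, yet half the excess remains in its
      \<open>k\<close>-th derivative at 0.\<close>
    define c where "c = ((deriv ^^ k) v 0 - M k ?h') / (2 * M k ?h')"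
    have c: "0 < c" using n pos by (simp add: c_def)
    define q where "q = (\<lambda>t. 1 * v t + (- (1 + c)) * T' t)"
    have q: "q \<in> ES ?h'" unfolding q_def by (rule ES_lincomb[OF v(1) T'E(1)])
    have "q t * T' t \<le> - c" if t: "0 \<le> t" "\<bar>T' t\<bar> = 1" for t
    proof -
      have "\<bar>v t\<bar> \<le> 1" using v(2) TE(2) t by (auto simp: E_def)
      moreover have "T' t = 1 \<or> T' t = - 1" using t by auto
      ultimately show ?thesis by (auto simp: q_def algebra_simps)
    qed
    then have "(deriv ^^ k) q 0 < 0"
      using extremal_no_ascent[OF h' k T' q c] by blast
    moreover have "(deriv ^^ k) q 0 = (deriv ^^ k) v 0 - (M k ?h' + c * M k ?h')"
      unfolding q_def funpow_deriv_lincomb[OF s(2) ES_smooth[OF T'E(1)]] T'E(2)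
      by (simp add: algebra_simps)
    moreover have "c * M k ?h' = ((deriv ^^ k) v 0 - M k ?h') / 2"
      using pos by (simp add: c_def)
    ultimately show False using n by argo
  qed
  then show ?thesis using gt by linarith
qed

section \<open>Raising all exponents to 1 in succession\<close>

lemma M_rotate: "M k (a # h) = M k (h @ [a])"
  by (simp add: M_def P_space_eq_ES ES_rotate)

text \<open>\<open>m\<close> counts the exponents already raised: each step rotates the head to the
  end and raises it to 1. One entry different from 1 makes one step strict.\<close>

lemma M_replicate:
  assumes k: "1 \<le> k"
  shows "\<forall>x\<in>set h. 0 < x \<and> x \<le> 1 \<Longrightarrow>
    M k (h @ replicate m 1) \<le> M k (replicate (length h + m) 1) \<and>
    ((\<exists>x\<in>set h. x \<noteq> 1) \<longrightarrow> M k (h @ replicate m 1) < M k (replicate (length h + m) 1))"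
proof (induction h arbitrary: m)
  case (Cons a h)
  have eq: "h @ replicate (Suc m) 1 = (h @ replicate m 1) @ [1 :: real]"
    by (simp add: replicate_append_same)
  have le: "M k ((a # h) @ replicate m 1) \<le> M k (h @ replicate (Suc m) 1) \<and>
    (a \<noteq> 1 \<longrightarrow> M k ((a # h) @ replicate m 1) < M k (h @ replicate (Suc m) 1))"
  proof (cases "a = 1")
    case True
    then show ?thesis by (simp add: eq M_rotate del: replicate.simps)
  next
    case False
    then have "M k ((h @ replicate m 1) @ [a]) < M k ((h @ replicate m 1) @ [1])"
      using Cons.prems k by (intro M_less_raise_entry) (auto simp: set_replicate_conv_if)
    then show ?thesis by (simp add: eq M_rotate del: replicate.simps)
  qed
  have "length (a # h) + m = length h + Suc m" by simp
  then show ?case using le Cons.IH[of "Suc m"] Cons.prems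
    by (smt (verit) list.set_intros(2) set_ConsD)
qed simp

theorem theorem1:
  fixes d k :: nat
  assumes "d \<ge> 1" and "k \<ge> 1"
  shows "(\<forall>h\<in>Delta d. M k h \<le> M k (replicate d 1)) \<and>
         (\<forall>h\<in>Delta d - {replicate d 1}. M k h < M k (replicate d 1))"
proof -
  have "M k h \<le> M k (replicate d 1) \<and> (h \<noteq> replicate d 1 \<longrightarrow> M k h < M k (replicate d 1))"
    if "h \<in> Delta d" for h
  proof -
    have h: "length h = d" "\<forall>x\<in>set h. 0 < x \<and> x \<le> 1" using that by (auto simp: Delta_def)
    have "h = replicate d 1" if "\<forall>x\<in>set h. x = 1"
      using replicate_length_same[OF that] h(1) by simp
    then show ?thesis using M_replicate[OF assms(2) h(2), of 0] h(1) by auto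
  qed
  then show ?thesis by blast
qed

end
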